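(* Let $K\ge1$. A quantum MAC in $\mathcal{Q}_{N,K}$ can have at most $2K$-order interference: for every $\mathbf{p}\in\mathcal{Q}_{N,K}$, every $k$ with $2K<k\le N$, every $S\subseteq\{1,\dots,N\}$ with $|S|=k$, and every choice of fixed inputs $a_j\in\{0,1\}$ for $j\notin S$, $$\sum_{(a_s)_{s\in S}\in\{0,1\}^S}\ \prod_{s\in S}(-1)^{a_s}\,p(0|a_1\cdots a_N)=0.$$
   Context: There are $N$ modes, one per sender, each with vacuum $|0\rangle$ and one-particle state $|1\rangle$; $|\mathbf{e}_i\rangle$ is the state with one particle in mode $i$ and none elsewhere; $\mathcal{H}_1^{\bm{\mathsf{A}}}=\mathrm{span}\{|\mathbf{e}_1\rangle,\dots,|\mathbf{e}_N\rangle\}$. Inputs $a_i$ and output $b$ are binary (in $\{0,1\}$). Joint NPE operation on a group $S$ of modes (at most one particle): a convex combination of channels on operators on $F_S=\mathrm{span}\{|0\rangle_S,|\mathbf{e}_s\rangle:s\in S\}$ ($|0\rangle_S$ = vacuum of $S$) of the form $X\mapsto\mathrm{Tr}_{E}[U(X\otimes|0\rangle\langle0|_E)U^\dagger]$, where $E$ consists of finitely many ancilla modes initially in vacuum and $U$ is a unitary on the span of states of $S\cup E$ with total particle number at most one which preserves total particle number (maps the vacuum line to itself and the one-particle subspace to itself). $(N,K)$-local quantum MACs $\mathcal{Q}_{N,K}$: MACs of the form $p(b|a_1\cdots a_N)=\mathrm{Tr}\left[\Pi_b\left(\bigotimes_{g=1}^G\mathcal{E}^{S_g}_{(a_s)_{s\in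 S_g}}\right)(\rho)\right]$, where $\rho$ is a density operator on $\mathcal{H}_1^{\bm{\mathsf{A}}}$, $\{S_1,\dots,S_G\}$ is a partition of $\{1,\dots,N\}$ into groups of size at most $K$, each $\mathcal{E}^{S_g}_{(a_s)_{s\in S_g}}$ is a joint NPE operation on group $S_g$ depending only on the inputs of that group, and $\{\Pi_b\}$ is a POVM. *)

theory Defs
  imports Complex_Main "HOL-Library.FuncSet" "HOL-Library.Disjoint_Sets"
begin

text \<open>
  A Hilbert space is given by a finite orthonormal basis \<^term>\<open>B\<close>; an operator on it is its matrix
  in that basis, of which only the entries with both indices in \<^term>\<open>B\<close> are meaningful.
\<close>

type_synonym 'i op = "'i \<Rightarrow> 'i \<Rightarrow> complex"

definition op_mult :: "'i set \<Rightarrow> 'i op \<Rightarrow> 'i op \<Rightarrow> 'i op" where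
  "op_mult B X Y = (\<lambda>x y. \<Sum>z\<in>B. X x z * Y z y)"

definition op_adj :: "'i op \<Rightarrow> 'i op" where
  "op_adj X = (\<lambda>x y. cnj (X y x))"

definition op_trace :: "'i set \<Rightarrow> 'i op \<Rightarrow> complex" where
  "op_trace B X = (\<Sum>x\<in>B. X x x)"

definition op_unit :: "'i \<Rightarrow> 'i \<Rightarrow> 'i op" where
  "op_unit k l = (\<lambda>x y. of_bool (x = k \<and> y = l))"

definition is_unitary :: "'i set \<Rightarrow> 'i op \<Rightarrow> bool" where
  "is_unitary B U \<longleftrightarrow>
     (\<forall>x\<in>B. \<forall>y\<in>B. op_mult B (op_adj U) U x y = of_bool (x = y) \<and>
                    op_mult B U (op_adj U) x y = of_bool (x = y))"

definition pos_semidef :: "'i set \<Rightarrow> 'i op \<Rightarrow> bool" where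
  "pos_semidef B X \<longleftrightarrow>
     (\<forall>v. (\<Sum>x\<in>B. \<Sum>y\<in>B. cnj (v x) * X x y * v y) \<in> \<real> \<and>
          0 \<le> Re (\<Sum>x\<in>B. \<Sum>y\<in>B. cnj (v x) * X x y * v y))"

definition density_op :: "'i set \<Rightarrow> 'i op \<Rightarrow> bool" where
  "density_op B \<rho> \<longleftrightarrow> pos_semidef B \<rho> \<and> op_trace B \<rho> = 1"

definition povm :: "'i set \<Rightarrow> 'o set \<Rightarrow> ('o \<Rightarrow> 'i op) \<Rightarrow> bool" where
  "povm B R M \<longleftrightarrow>
     (\<forall>b\<in>R. pos_semidef B (M b)) \<and>
     (\<forall>x\<in>B. \<forall>y\<in>B. (\<Sum>b\<in>R. M b x y) = of_bool (x = y))"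

text \<open>
  Basis of the span of the states with at most one particle in the modes \<^term>\<open>S\<close>:
  \<^term>\<open>None\<close> is the vacuum, and \<^term>\<open>Some s\<close> has one particle in mode \<^term>\<open>s\<close>.
\<close>

definition fock1 :: "'m set \<Rightarrow> 'm option set" where
  "fock1 S = insert None (Some ` S)"

fun particles :: "'m option \<Rightarrow> nat" where
  "particles None = 0"
| "particles (Some s) = 1"

text \<open>
  The modes of a system together with its ancillas form a disjoint sum.  The next function
  embeds the at-most-one-particle basis states of the sum into the product of the two bases.
\<close>

fun fock1_split :: "('m + 'n) option \<Rightarrow> 'm option \<times> 'n option" where
  "fock1_split None = (None, None)"
| "fock1_split (Some (Inl s)) = (Some s, None)"
| "fock1_split (Some (Inr e)) = (None, Some e)"

definition tensor_vacuum :: "'m option op \<Rightarrow> ('m + 'n) option op" where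
  "tensor_vacuum X = (\<lambda>x y.
     X (fst (fock1_split x)) (fst (fock1_split y)) *
     op_unit None None (snd (fock1_split x)) (snd (fock1_split y)))"

definition ancilla_trace :: "'m set \<Rightarrow> 'n set \<Rightarrow> ('m + 'n) option op \<Rightarrow> 'm option op" where
  "ancilla_trace S E Y = (\<lambda>i j.
     \<Sum>x | x \<in> fock1 (S <+> E) \<and> fst (fock1_split x) = i.
     \<Sum>y | y \<in> fock1 (S <+> E) \<and> fst (fock1_split y) = j \<and>
           snd (fock1_split y) = snd (fock1_split x). Y x y)"

definition npe_unitary :: "'m set \<Rightarrow> 'n set \<Rightarrow> ('m + 'n) option op \<Rightarrow> bool" where
  "npe_unitary S E U \<longleftrightarrow>
     is_unitary (fock1 (S <+> E)) U \<and>
     (\<forall>x \<in> fock1 (S <+> E). \<forall>y \<in> fock1 (S <+> E). particles x \<noteq> particles y \<longrightarrow> U x y = 0)"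

definition npe_channel ::
    "'m set \<Rightarrow> 'n set \<Rightarrow> ('m + 'n) option op \<Rightarrow> 'm option op \<Rightarrow> 'm option op" where
  "npe_channel S E U X =
     ancilla_trace S E
       (op_mult (fock1 (S <+> E)) (op_mult (fock1 (S <+> E)) U (tensor_vacuum X)) (op_adj U))"

text \<open>
  The \<^term>\<open>r\<close>-th term of the convex combination has \<^term>\<open>m r\<close> ancilla modes.
\<close>

definition joint_npe :: "'m set \<Rightarrow> ('m option op \<Rightarrow> 'm option op) \<Rightarrow> bool" where
  "joint_npe S C \<longleftrightarrow>
     (\<exists>(n :: nat) (w :: nat \<Rightarrow> real) (m :: nat \<Rightarrow> nat) (U :: nat \<Rightarrow> ('m + nat) option op).
        (\<forall>r<n. 0 \<le> w r \<and> npe_unitary S {..<m r} (U r)) \<and>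
        (\<Sum>r<n. w r) = 1 \<and>
        (\<forall>X. \<forall>i\<in>fock1 S. \<forall>j\<in>fock1 S.
           C X i j = (\<Sum>r<n. complex_of_real (w r) * npe_channel S {..<m r} (U r) X i j)))"

text \<open>
  For a partition \<^term>\<open>P\<close> of the modes into groups, the product of the spaces of the groups has the
  product basis, and the tensor product of the maps \<^term>\<open>C T\<close> is the linear map
  determined by its values on products of matrix units.
\<close>

definition group_basis :: "'m set set \<Rightarrow> ('m set \<Rightarrow> 'm option) set" where
  "group_basis P = (\<Pi>\<^sub>E T\<in>P. fock1 T)"

definition tensor_channel ::
    "'m set set \<Rightarrow> ('m set \<Rightarrow> 'm option op \<Rightarrow> 'm option op) \<Rightarrow>
     ('m set \<Rightarrow> 'm option) op \<Rightarrow> ('m set \<Rightarrow> 'm option) op" where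
  "tensor_channel P C X = (\<lambda>x y.
     \<Sum>k\<in>group_basis P. \<Sum>l\<in>group_basis P.
       X k l * (\<Prod>T\<in>P. C T (op_unit (k T) (l T)) (x T) (y T)))"

text \<open>
  In the product basis, the state with one particle in mode \<^term>\<open>i\<close> and none elsewhere has a
  particle in the group of \<^term>\<open>i\<close> and vacuum in every other group.
\<close>

definition single_particle :: "'m set set \<Rightarrow> 'm \<Rightarrow> 'm set \<Rightarrow> 'm option" where
  "single_particle P i = (\<lambda>T\<in>P. if i \<in> T then Some i else None)"

definition embed_one_particle :: "'m set \<Rightarrow> 'm set set \<Rightarrow> 'm op \<Rightarrow> ('m set \<Rightarrow> 'm option) op" where
  "embed_one_particle A P \<rho> = (\<lambda>x y.
     \<Sum>i\<in>A. \<Sum>j\<in>A. \<rho> i j * op_unit (single_particle P i) (single_particle P j) x y)"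

text \<open>
  A multiple-access channel \<^term>\<open>p\<close> is written \<^term>\<open>p b a\<close> for the probability of output
  \<^term>\<open>b\<close> given the input string \<^term>\<open>a\<close>.  The operation of group \<^term>\<open>T\<close> takes as argument
  the restriction of the input string to \<^term>\<open>T\<close>.
\<close>

definition quantum_MACs :: "nat \<Rightarrow> nat \<Rightarrow> (nat \<Rightarrow> (nat \<Rightarrow> nat) \<Rightarrow> real) set" where
  "quantum_MACs N K = {p.
     \<exists>P \<rho> C M.
       partition_on {1..N} P \<and> (\<forall>T\<in>P. card T \<le> K) \<and>
       density_op {1..N} \<rho> \<and>
       (\<forall>T\<in>P. \<forall>\<alpha> \<in> T \<rightarrow>\<^sub>E {0, 1}. joint_npe T (C T \<alpha>)) \<and>
       povm (group_basis P) {0, 1} M \<and>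
       (\<forall>b \<in> {0, 1}. \<forall>a \<in> {1..N} \<rightarrow>\<^sub>E {0, 1}.
          complex_of_real (p b a) =
          op_trace (group_basis P)
            (op_mult (group_basis P) (M b)
              (tensor_channel P (\<lambda>T. C T (restrict a T)) (embed_one_particle {1..N} P \<rho>))))}"

end

theory Submission
  imports Defs
begin

text \<open>
  An NPE operation fixes the vacuum of its group, whatever the inputs.  Expanding \<open>\<rho>\<close> into
  matrix units \<open>|e\<^sub>i\<rangle>\<langle>e\<^sub>j|\<close>, the contribution of the pair \<open>(i, j)\<close> therefore depends only on the inputs
  of the groups containing \<open>i\<close> or \<open>j\<close>, of which there are at most \<open>2K\<close>.  If \<open>S\<close> has more than \<open>2K\<close>
  elements, each contribution is independent of some input \<open>a\<^sub>s\<close> with \<open>s \<in> S\<close>, and its alternating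
  sum over that input vanishes.
\<close>

lemma finite_fock1 [simp]: "finite S \<Longrightarrow> finite (fock1 S)"
  by (simp add: fock1_def)

lemma None_in_fock1 [simp]: "None \<in> fock1 S"
  by (simp add: fock1_def)

text \<open>Conservation of particle number leaves only the vacuum entry in the vacuum column of
  \<open>U\<close>, and unitarity gives it modulus 1. Its phase cancels against the conjugate, so
  \<open>U\<close> maps |0><0| to itself.\<close>

lemma npe_unitary_vacuum_column:
  fixes U :: "('m + 'n) option op"
  assumes "finite S" "finite E" "npe_unitary S E U"
    and "x \<in> fock1 (S <+> E)" "y \<in> fock1 (S <+> E)"
  shows "U x None * cnj (U y None) = of_bool (x = None \<and> y = None)"
proof -
  have zero: "U z None = 0" if "z \<in> fock1 (S <+> E)" "z \<noteq> None" for z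
  proof -
    from that(2) have "particles z \<noteq> particles (None :: ('m + 'n) option)"
      by (cases z) auto
    with that(1) assms(3) show ?thesis
      by (simp add: npe_unitary_def)
  qed
  have fin: "finite (fock1 (S <+> E))"
    using assms by simp
  \<comment> \<open>The diagonal vacuum entry of the identity \<open>op_adj U\<close> times
    \<open>U\<close> = 1.\<close>
  have "1 = (\<Sum>z\<in>fock1 (S <+> E). cnj (U z None) * U z None)"
    using assms(3) by (simp add: npe_unitary_def is_unitary_def op_mult_def op_adj_def)
  also have "\<dots> = (\<Sum>z\<in>fock1 (S <+> E). if z = None then cnj (U None None) * U None None else 0)"
    by (rule sum.cong) (auto simp: zero)
  also have "\<dots> = U None None * cnj (U None None)"
    using fin by (simp add: mult.commute)
  finally show ?thesis
    using zero assms(4,5) by (cases "x = None"; cases "y = None") auto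
qed

text \<open>Only the joint vacuum splits into two vacua, so this is |0><0| of system and ancillas
  together.\<close>

lemma tensor_vacuum_vacuum:
  "tensor_vacuum (op_unit None None) x y = of_bool (x = None \<and> y = None)"
  by (cases x rule: fock1_split.cases; cases y rule: fock1_split.cases)
    (auto simp: tensor_vacuum_def op_unit_def)

text \<open>The dilated input is the joint vacuum, which \<open>U\<close> fixes up to a phase;
  tracing out the ancillas then leaves the vacuum of \<open>S\<close>.\<close>

lemma npe_channel_vacuum:
  fixes U :: "('m + 'n) option op"
  assumes fin: "finite S" "finite E" and U: "npe_unitary S E U"
  shows "npe_channel S E U (op_unit None None) i j = of_bool (i = None \<and> j = None)"
proof -
  let ?F = "fock1 (S <+> E)"
  have finF: "finite ?F"
    using fin by simp
  have "op_mult ?F U (tensor_vacuum (op_unit None None)) x y = (if y = None then U x None else 0)" for x y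
  proof -
    have "op_mult ?F U (tensor_vacuum (op_unit None None)) x y =
        (\<Sum>z\<in>?F. if z = None then U x None * of_bool (y = None) else 0)"
      unfolding op_mult_def by (rule sum.cong) (auto simp: tensor_vacuum_vacuum)
    then show ?thesis
      using finF by simp
  qed
  then have "op_mult ?F (op_mult ?F U (tensor_vacuum (op_unit None None))) (op_adj U) x y =
      (\<Sum>z\<in>?F. if z = None then U x None * cnj (U y None) else 0)" for x y
    unfolding op_mult_def [of _ "op_mult _ _ _"] by (intro sum.cong) (auto simp: op_adj_def)
  then have out: "op_mult ?F (op_mult ?F U (tensor_vacuum (op_unit None None))) (op_adj U) x y =
      of_bool (x = None \<and> y = None)" if "x \<in> ?F" "y \<in> ?F" for x y
    using npe_unitary_vacuum_column [OF fin U that] finF by simp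
  have "npe_channel S E U (op_unit None None) i j =
     (\<Sum>x | x \<in> ?F \<and> fst (fock1_split x) = i.
      \<Sum>y | y \<in> ?F \<and> fst (fock1_split y) = j \<and> snd (fock1_split y) = snd (fock1_split x).
        if y = None then of_bool (x = None) else 0)"
    unfolding npe_channel_def ancilla_trace_def by (intro sum.cong) (auto simp: out)
  \<comment> \<open>Once \<open>x = None\<close>, the ancilla parts of \<open>x\<close> and
    \<open>y = None\<close> agree, so \<open>y = None\<close> is in the inner range exactly when
    \<open>j = None\<close>.\<close>
  also have "\<dots> = (\<Sum>x | x \<in> ?F \<and> fst (fock1_split x) = i. if x = None then of_bool (j = None) else 0)"
    using finF by (intro sum.cong) auto
  also have "\<dots> = of_bool (i = None \<and> j = None)"
    using finF by auto
  finally show ?thesis .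
qed

text \<open>Each channel of the convex combination fixes the vacuum, and the weights sum to 1. The
  indices lie in \<open>fock1 S\<close> because \<open>joint_npe\<close> prescribes \<open>C\<close>
  only on those entries.\<close>

lemma joint_npe_vacuum:
  fixes S :: "'m set"
  assumes "finite S" "joint_npe S C" "i \<in> fock1 S" "j \<in> fock1 S"
  shows "C (op_unit None None) i j = of_bool (i = None \<and> j = None)"
proof -
  from assms(2) obtain n :: nat and w :: "nat \<Rightarrow> real" and m :: "nat \<Rightarrow> nat"
      and U :: "nat \<Rightarrow> ('m + nat) option op" where
    npe: "\<And>r. r < n \<Longrightarrow> npe_unitary S {..<m r} (U r)" and w: "(\<Sum>r<n. w r) = 1" and
    C: "\<And>X i j. i \<in> fock1 S \<Longrightarrow> j \<in> fock1 S \<Longrightarrow>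
      C X i j = (\<Sum>r<n. complex_of_real (w r) * npe_channel S {..<m r} (U r) X i j)"
    unfolding joint_npe_def by blast
  have "C (op_unit None None) i j = (\<Sum>r<n. complex_of_real (w r) * of_bool (i = None \<and> j = None))"
    unfolding C [OF assms(3,4)]
    by (intro sum.cong) (simp_all add: npe_channel_vacuum [OF assms(1) _ npe])
  also have "\<dots> = complex_of_real (\<Sum>r<n. w r) * of_bool (i = None \<and> j = None)"
    by (simp flip: sum_distrib_right)
  finally show ?thesis
    by (simp add: w)
qed

text \<open>Flipping the bit at \<open>s\<close> is an involution of the cube that reverses the sign
  and preserves \<open>f\<close>, so the sum equals its own negative.\<close>

lemma alternating_sum_eq_0:
  fixes f :: "('a \<Rightarrow> nat) \<Rightarrow> complex"
  assumes "finite S" "s \<in> S"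
    and f: "\<And>a. a \<in> S \<rightarrow>\<^sub>E {0, 1} \<Longrightarrow> f (a(s := 1 - a s)) = f a"
  shows "(\<Sum>a\<in>S \<rightarrow>\<^sub>E {0, 1}. (\<Prod>t\<in>S. (-1) ^ a t) * f a) = 0"
proof -
  \<comment> \<open>The subtraction \<open>1 - a s\<close> is on naturals; it exchanges 0 and 1
    since \<open>a s\<close> is a bit.\<close>
  let ?g = "\<lambda>a. (\<Prod>t\<in>S. (-1) ^ a t) * f a" and ?flip = "\<lambda>a. a(s := 1 - a s)"
  have flip: "?flip a \<in> S \<rightarrow>\<^sub>E {0, 1} \<and> ?flip (?flip a) = a \<and> ?g (?flip a) = - ?g a"
    if a: "a \<in> S \<rightarrow>\<^sub>E {0, 1}" for a
  proof -
    have as: "a s \<in> {0, 1}"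
      using a assms(2) by auto
    have "(\<Prod>t\<in>S. (-1::complex) ^ ?flip a t) = (-1) ^ (1 - a s) * (\<Prod>t\<in>S - {s}. (-1) ^ a t)"
      using assms by (simp add: prod.remove [of S s])
    also have "\<dots> = - (\<Prod>t\<in>S. (-1) ^ a t)"
      using assms as by (auto simp: prod.remove [of S s])
    finally show ?thesis
      using a as assms(2) f [OF a] by (auto simp: PiE_iff extensional_def fun_eq_iff)
  qed
  have "sum ?g (S \<rightarrow>\<^sub>E {0, 1}) = (\<Sum>a\<in>S \<rightarrow>\<^sub>E {0, 1}. - ?g a)"
    by (rule sum.reindex_bij_witness [of _ ?flip ?flip]) (use flip in auto)
  then show ?thesis
    by (simp add: sum_negf)
qed

text \<open>The equality holds factor by factor: the group containing \<open>s\<close> contains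
  neither \<open>i\<close> nor \<open>j\<close>, so it receives |0><0| and returns it for either
  input, while every other group sees the same restricted input.\<close>

lemma single_particle_product_depends_on_two_groups:
  assumes P: "partition_on A P" "finite A"
    and C: "\<And>T \<alpha>. T \<in> P \<Longrightarrow> \<alpha> \<in> T \<rightarrow>\<^sub>E {0, 1} \<Longrightarrow> joint_npe T (C T \<alpha>)"
    and "x \<in> group_basis P" "y \<in> group_basis P"
    and a: "a \<in> A \<rightarrow>\<^sub>E {0, 1}" and a': "a' \<in> A \<rightarrow>\<^sub>E {0, 1}"
    and agree: "\<And>t. t \<noteq> s \<Longrightarrow> a' t = a t"
    and s: "\<And>T. T \<in> P \<Longrightarrow> s \<in> T \<Longrightarrow> i \<notin> T \<and> j \<notin> T"
  shows "(\<Prod>T\<in>P. C T (restrict a' T) (op_unit (single_particle P i T) (single_particle P j T)) (x T) (y T)) =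
         (\<Prod>T\<in>P. C T (restrict a T) (op_unit (single_particle P i T) (single_particle P j T)) (x T) (y T))"
proof (rule prod.cong)
  fix T assume T: "T \<in> P"
  then have TA: "T \<subseteq> A"
    using P by (auto simp: partition_on_def)
  show "C T (restrict a' T) (op_unit (single_particle P i T) (single_particle P j T)) (x T) (y T) =
        C T (restrict a T) (op_unit (single_particle P i T) (single_particle P j T)) (x T) (y T)"
  proof (cases "s \<in> T")
    case True
    then have "single_particle P i T = None" "single_particle P j T = None"
      using s T by (auto simp: single_particle_def)
    moreover have "x T \<in> fock1 T" "y T \<in> fock1 T" "finite T"
      using assms(4,5) T TA P(2) by (auto simp: group_basis_def intro: finite_subset)
    moreover have "restrict a T \<in> T \<rightarrow>\<^sub>E {0, 1}" "restrict a' T \<in> T \<rightarrow>\<^sub>E {0, 1}"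
      using a a' TA by (auto simp: PiE_iff)
    ultimately show ?thesis
      by (simp add: joint_npe_vacuum C T)
  next
    case False
    then have "restrict a' T = restrict a T"
      using agree by (metis restrict_ext)
    then show ?thesis
      by simp
  qed
qed simp

theorem proposition11:
  fixes N K k :: nat
    and p :: "nat \<Rightarrow> (nat \<Rightarrow> nat) \<Rightarrow> real"
    and S :: "nat set"
    and c :: "nat \<Rightarrow> nat"
  assumes "1 \<le> K"
    and "p \<in> quantum_MACs N K"
    and "2 * K < k" and "k \<le> N"
    and "S \<subseteq> {1..N}" and "card S = k"
    and "c \<in> ({1..N} - S) \<rightarrow>\<^sub>E {0, 1}"
  shows "(\<Sum>a \<in> S \<rightarrow>\<^sub>E {0, 1}. (\<Prod>s\<in>S. (-1) ^ a s) * p 0 (override_on c a S)) = 0"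
proof -
  let ?A = "{1..N}"
  from assms(2) obtain P \<rho> C M where
    P: "partition_on ?A P" and cardP: "\<And>T. T \<in> P \<Longrightarrow> card T \<le> K" and
    C: "\<And>T \<alpha>. T \<in> P \<Longrightarrow> \<alpha> \<in> T \<rightarrow>\<^sub>E {0, 1} \<Longrightarrow> joint_npe T (C T \<alpha>)" and
    p: "\<And>a. a \<in> ?A \<rightarrow>\<^sub>E {0, 1} \<Longrightarrow> complex_of_real (p 0 a) =
          op_trace (group_basis P) (op_mult (group_basis P) (M (0::nat))
            (tensor_channel P (\<lambda>T. C T (restrict a T)) (embed_one_particle ?A P \<rho>)))"
    unfolding quantum_MACs_def mem_Collect_eq by (elim exE conjE) (rule that, simp_all)
  let ?G = "group_basis P" and ?o = "\<lambda>a. override_on c a S"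
  \<comment> \<open>One summand of the fully expanded trace: \<open>x\<close> and \<open>z\<close>
    come from the trace and the product with \<open>M 0\<close>, \<open>q\<close> and
    \<open>l\<close> from the matrix units fed to the channel, \<open>i\<close> and \<open>j\<close>
    from \<rho>.\<close>
  define F where "F x z q l i j a =
      M 0 x z * (\<rho> i j * op_unit (single_particle P i) (single_particle P j) q l *
        (\<Prod>T\<in>P. C T (restrict a T) (op_unit (q T) (l T)) (z T) (x T)))" for x z q l i j a
  have p_eq: "complex_of_real (p 0 a) =
      (\<Sum>x\<in>?G. \<Sum>z\<in>?G. \<Sum>q\<in>?G. \<Sum>l\<in>?G. \<Sum>i\<in>?A. \<Sum>j\<in>?A. F x z q l i j a)"
    if "a \<in> ?A \<rightarrow>\<^sub>E {0, 1}" for a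
    unfolding p [OF that] op_trace_def op_mult_def tensor_channel_def embed_one_particle_def F_def
      sum_distrib_left sum_distrib_right ..
  have finS: "finite S"
    using assms(5) finite_subset by blast
  have o: "?o a \<in> ?A \<rightarrow>\<^sub>E {0, 1}" if "a \<in> S \<rightarrow>\<^sub>E {0, 1}" for a
    using that assms(5,7) by (auto simp: PiE_iff override_on_def extensional_def)
  have zero: "(\<Sum>a\<in>S \<rightarrow>\<^sub>E {0, 1}. (\<Prod>t\<in>S. (-1) ^ a t) * F x z q l i j (?o a)) = 0"
    if xz: "x \<in> ?G" "z \<in> ?G" and ij: "i \<in> ?A" "j \<in> ?A" for x z q l i j
  \<comment> \<open>For any other \<open>q\<close>, \<open>l\<close> the matrix unit has entry 0 and
    \<open>F\<close> vanishes.\<close>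
  proof (cases "q = single_particle P i \<and> l = single_particle P j")
    case True
    have "\<exists>T\<in>P. t \<in> T" if "t \<in> ?A" for t
      using P that by (auto simp: partition_on_def)
    with ij obtain T1 T2 where T: "T1 \<in> P" "i \<in> T1" "T2 \<in> P" "j \<in> T2"
      by blast
    have unique: "T = T'" if "T \<in> P" "T' \<in> P" "t \<in> T" "t \<in> T'" for T T' t
      using P that by (auto simp: partition_on_def disjoint_def)
    have "T1 \<union> T2 \<subseteq> ?A"
      using P T by (auto simp: partition_on_def)
    then have "finite (T1 \<union> T2)"
      using finite_subset by blast
    \<comment> \<open>The groups of \<open>i\<close> and \<open>j\<close>, possibly equal, cover at
      most \<open>2 * K\<close> senders, fewer than \<open>S\<close> has; this leaves a sender
      \<open>s\<close> of \<open>S\<close> outside both.\<close>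
    moreover have "card (T1 \<union> T2) < card S"
      using card_Un_le [of T1 T2] cardP [OF T(1)] cardP [OF T(3)] assms(3,6) by linarith
    ultimately have "\<not> S \<subseteq> T1 \<union> T2"
      using card_mono leD by blast
    then obtain s where s: "s \<in> S" "s \<notin> T1" "s \<notin> T2"
      by auto
    have "F x z q l i j (?o (a(s := 1 - a s))) = F x z q l i j (?o a)" if a: "a \<in> S \<rightarrow>\<^sub>E {0, 1}" for a
    proof -
      have flip: "a(s := 1 - a s) \<in> S \<rightarrow>\<^sub>E {0, 1}"
        using a s(1) by (auto simp: PiE_iff extensional_def)
      \<comment> \<open>By disjointness \<open>i\<close> lies only in \<open>T1\<close> and
        \<open>j\<close> only in \<open>T2\<close>, and neither group contains
        \<open>s\<close>.\<close>
      have vacuum: "i \<notin> T \<and> j \<notin> T" if "T \<in> P" "s \<in> T" for T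
        using that T s unique by metis
      have agree: "?o (a(s := 1 - a s)) t = ?o a t" if "t \<noteq> s" for t
        using that by (simp add: override_on_def)
      from single_particle_product_depends_on_two_groups
          [where C = C, OF P finite_atLeastAtMost C xz(2,1) o [OF a] o [OF flip] agree vacuum]
      show ?thesis
        using True by (simp add: F_def)
    qed
    then show ?thesis
      by (rule alternating_sum_eq_0 [where f = "\<lambda>a. F x z q l i j (?o a)", OF finS s(1)])
  next
    case False
    then show ?thesis
      by (auto simp: F_def op_unit_def)
  qed
  \<comment> \<open>The real sum is embedded into the complex numbers, where the matrix expansion of
    \<open>p\<close> is available.\<close>
  have "complex_of_real (\<Sum>a\<in>S \<rightarrow>\<^sub>E {0, 1}. (\<Prod>s\<in>S. (-1) ^ a s) * p 0 (?o a)) =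
      (\<Sum>a\<in>S \<rightarrow>\<^sub>E {0, 1}. \<Sum>x\<in>?G. \<Sum>z\<in>?G. \<Sum>q\<in>?G. \<Sum>l\<in>?G. \<Sum>i\<in>?A. \<Sum>j\<in>?A.
        (\<Prod>s\<in>S. (-1) ^ a s) * F x z q l i j (?o a))"
    by (simp add: p_eq o sum_distrib_left del: One_nat_def)
  also have "\<dots> = (\<Sum>x\<in>?G. \<Sum>z\<in>?G. \<Sum>q\<in>?G. \<Sum>l\<in>?G. \<Sum>i\<in>?A. \<Sum>j\<in>?A. \<Sum>a\<in>S \<rightarrow>\<^sub>E {0, 1}.
        (\<Prod>s\<in>S. (-1) ^ a s) * F x z q l i j (?o a))"
    \<comment> \<open>The sum over inputs moves inward past the six index sums one at a time, so
      that \<open>zero\<close> applies to each summand.\<close>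
    by ((rule trans [OF sum.swap], rule sum.cong [OF refl])+, rule refl)
  also have "\<dots> = 0"
    by (simp add: zero del: One_nat_def)
  finally show ?thesis
    by (simp only: of_real_eq_0_iff)
qed

end
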